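(* Let $s\in\mathbb{N}$ and $a\in\mathbb{Z}$, let $G$ be a graph and $S\subseteq V(G)$ with $|S|=s$. If $b\geq\max\{s+2a+16,\ s+6\}$ and $\mathcal{E}(G;S,q)=aq^2-bq+c$, then for all $1\leq k\leq s$, $$\sum_{W\in\binom{S}{k}}|\mathrm{Obs}(G;W)|=\binom{s-2}{k-2}\sum_{W\in\binom{S}{2}}|\mathrm{Obs}(G;W)|+\left(\binom{s-1}{k-1}-(s-1)\binom{s-2}{k-2}\right)\sum_{v\in S}|\mathrm{Obs}(G;\{v\})|.$$
   Context: Graphs are finite and simple; $N[X]$ is the closed neighborhood of $X$. Power domination process on a graph $H$ from $T\subseteq V(H)$: set $B:=N[T]$; then, while some $x\in B$ has exactly one vertex $y$ of $N[x]$ outside $B$, add $y$ to $B$. The final set is $\mathrm{Obs}(H;T)$ (with $\mathrm{Obs}(H;\emptyset)=\emptyset$). For $S\subseteq V(H)$, $\mathcal{E}(H;S,q)=\sum_{W\subseteq S}|\mathrm{Obs}(H;W)|\,q^{|S\setminus W|}(1-q)^{|W|}$, a polynomial in $q$. $\binom{S}{k}$ is the set of $k$-element subsets of $S$; binomial coefficients with negative lower index are $0$. *)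

theory Defs
  imports "Graph_Theory.Digraph" "HOL-Computational_Algebra.Polynomial"
begin

text \<open>A finite simple graph is a digraph satisfying the locale predicate \<open>graph\<close> (finite,
  loop-free, no parallel arcs, symmetric); \<open>u \<rightarrow>\<^bsub>G\<^esub> v\<close> is adjacency.\<close>

definition closed_nbhd :: "('a, 'b) pre_digraph \<Rightarrow> 'a set \<Rightarrow> 'a set" where
  "closed_nbhd G X = X \<union> {v. \<exists>u\<in>X. u \<rightarrow>\<^bsub>G\<^esub> v}"

definition pd_step :: "('a, 'b) pre_digraph \<Rightarrow> 'a set \<Rightarrow> 'a set \<Rightarrow> bool" where
  "pd_step G B B' \<longleftrightarrow> (\<exists>x\<in>B. \<exists>y. closed_nbhd G {x} - B = {y} \<and> B' = insert y B)"

definition pd_final :: "('a, 'b) pre_digraph \<Rightarrow> 'a set \<Rightarrow> 'a set \<Rightarrow> bool" where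
  "pd_final G T B \<longleftrightarrow> (pd_step G)\<^sup>*\<^sup>* (closed_nbhd G T) B \<and> (\<nexists>B'. pd_step G B B')"

text \<open>The process may be run in any order; \<open>pd_final_ex1\<close> below shows that the final set exists and
  does not depend on the choices made, so the description operator is well-defined for
  \<open>T \<subseteq> verts G\<close>.\<close>

definition Obs :: "('a, 'b) pre_digraph \<Rightarrow> 'a set \<Rightarrow> 'a set" where
  "Obs G T = (THE B. pd_final G T B)"

lemma pd_steps_subset_closed:
  assumes "(pd_step G)\<^sup>*\<^sup>* A B" "A \<subseteq> C" "\<nexists>C'. pd_step G C C'"
  shows "B \<subseteq> C"
  using assms(1)
proof (induction rule: rtranclp_induct)
  case base
  show ?case by (fact assms(2))
next
  case (step B B')
  then obtain x y where xy: "x \<in> B" "closed_nbhd G {x} - B = {y}" "B' = insert y B"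
    unfolding pd_step_def by blast
  have "y \<in> C"
  proof (rule ccontr)
    assume "y \<notin> C"
    with xy step.IH have "x \<in> C" "closed_nbhd G {x} - C = {y}"
      by blast+
    then have "pd_step G C (insert y C)"
      unfolding pd_step_def by blast
    with assms(3) show False by blast
  qed
  with xy step.IH show ?case by blast
qed

lemma closed_nbhd_subset:
  assumes "graph G" "X \<subseteq> verts G"
  shows "closed_nbhd G X \<subseteq> verts G"
proof -
  interpret graph G by fact
  show ?thesis
    using assms(2) unfolding closed_nbhd_def by (auto dest: adj_in_verts)
qed

lemma pd_steps_final_ex:
  assumes "graph G" "A \<subseteq> verts G"
  shows "\<exists>B. (pd_step G)\<^sup>*\<^sup>* A B \<and> (\<nexists>B'. pd_step G B B')"
  using assms(2)
proof (induction "card (verts G - A)" arbitrary: A rule: less_induct)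
  case less
  interpret graph G by fact
  show ?case
  proof (cases "\<exists>A'. pd_step G A A'")
    case True
    then obtain x y where xy: "x \<in> A" "closed_nbhd G {x} - A = {y}"
      and st: "pd_step G A (insert y A)"
      unfolding pd_step_def by blast
    have "y \<in> verts G - A"
      using xy less.prems closed_nbhd_subset[OF assms(1), of "{x}"] by blast
    then have "verts G - insert y A \<subset> verts G - A" by blast
    then have "card (verts G - insert y A) < card (verts G - A)"
      by (intro psubset_card_mono) auto
    moreover have "insert y A \<subseteq> verts G"
      using \<open>y \<in> verts G - A\<close> less.prems by blast
    ultimately obtain B where "(pd_step G)\<^sup>*\<^sup>* (insert y A) B" "\<nexists>B'. pd_step G B B'"
      using less.hyps by blast
    with st show ?thesis by (meson converse_rtranclp_into_rtranclp)
  qed blast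
qed

lemma pd_final_ex1:
  assumes "graph G" "T \<subseteq> verts G"
  shows "\<exists>!B. pd_final G T B"
proof (rule ex_ex1I)
  show "\<exists>B. pd_final G T B"
    using pd_steps_final_ex[OF assms(1) closed_nbhd_subset[OF assms]]
    unfolding pd_final_def .
next
  have incr: "A \<subseteq> B" if "(pd_step G)\<^sup>*\<^sup>* A B" for A B
    using that by (induction rule: rtranclp_induct) (auto simp: pd_step_def)
  fix B C assume "pd_final G T B" "pd_final G T C"
  then show "B = C"
    unfolding pd_final_def by (meson incr pd_steps_subset_closed subset_antisym)
qed

text \<open>As a polynomial in \<open>q\<close>: \<open>[:0, 1:]\<close> is \<open>q\<close> and \<open>[:1, -1:]\<close> is \<open>1 - q\<close>.\<close>

definition expected_obs :: "('a, 'b) pre_digraph \<Rightarrow> 'a set \<Rightarrow> real poly" where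
  "expected_obs G S =
     (\<Sum>W\<in>Pow S. of_nat (card (Obs G W)) * [:0, 1:] ^ card (S - W) * [:1, -1:] ^ card W)"

text \<open>The lower index ranges over the integers, since truncated subtraction on the naturals would
  give the wrong value for \<open>k - 2\<close> at \<open>k = 1\<close>. With \<open>1 \<le> k \<le> s\<close>, a negative upper index
  \<open>s - 2\<close> only occurs together with the negative lower index \<open>k - 2\<close>, where the value is \<open>0\<close>.\<close>

definition int_binom :: "int \<Rightarrow> int \<Rightarrow> int" where
  "int_binom n k = (if k < 0 then 0 else int (nat n choose nat k))"

end

theory Submission
  imports Defs
begin

text \<open>Let \<open>f k\<close> be the sum of \<open>card (Obs G W)\<close> over the \<open>k\<close>-subsets \<open>W\<close> of \<open>S\<close>, and put
  \<open>p = 1 - q\<close>. The expected value is then \<open>\<Sum>k\<le>s. f k * q ^ (s - k) * p ^ k\<close>, so that the \<open>f k\<close>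
  are its coordinates in the (unnormalised) Bernstein basis of degree \<open>s\<close>. Rewritten in powers of
  \<open>p\<close>, the given quadratic is \<open>a p\<^sup>2 + (b - 2a) p + (a - b + c)\<close>. The Bernstein coordinates of
  \<open>p ^ j = p ^ j * (p + q) ^ (s - j)\<close> are the numbers \<open>s - j choose k - j\<close>, hence \<open>f k\<close> is a
  combination of three binomial coefficients whose weights are read off from \<open>f 0 = 0\<close>, \<open>f 1\<close>
  and \<open>f 2\<close>.\<close>

text \<open>Linear independence of the Bernstein basis. At \<open>q = 1\<close> every term with
  \<open>k > 0\<close> vanishes, which gives \<open>g 0 = 0\<close>; then \<open>1 - q\<close> can
  be cancelled and the shifted sequence has degree one less.\<close>

lemma bernstein_coeffs_eq_0:
  fixes g :: "nat \<Rightarrow> 'a::idom"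
  assumes "(\<Sum>k\<le>s. [:g k:] * [:0, 1:] ^ (s - k) * [:1, -1:] ^ k) = 0" "k \<le> s"
  shows "g k = 0"
  using assms
proof (induction s arbitrary: g k)
  case 0
  then show ?case by simp
next
  case (Suc s)
  let ?r = "\<Sum>k\<le>s. [:g (Suc k):] * [:0, 1:] ^ (s - k) * [:1, -1:] ^ k"
  have split: "[:g 0:] * [:0, 1:] ^ Suc s + [:1, -1:] * ?r = 0"
    using Suc.prems(1)
    by (simp only: sum.atMost_Suc_shift sum_distrib_left diff_Suc_Suc diff_zero power_Suc power_0
        mult_1_left mult_1_right mult_ac)
  have "poly ([:g 0:] * [:0, 1:] ^ Suc s + [:1, -1:] * ?r) 1 = g 0"
    by (simp only: poly_add poly_mult poly_power) simp
  then have g0: "g 0 = 0" using split by (simp only: poly_0)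
  then have "[:1, -1:] * ?r = 0"
    using split by (simp only: pCons_0_0 mult_zero_left add_0)
  then have "?r = 0"
    by (simp only: mult_eq_0_iff) simp
  then have "g (Suc i) = 0" if "i \<le> s" for i
    using Suc.IH[of "\<lambda>k. g (Suc k)" i] that by blast
  with g0 Suc.prems(2) show ?case by (cases k) auto
qed

lemma power_eq_bernstein_sum:
  fixes p q :: "'a::comm_ring_1"
  assumes "p + q = 1"
  shows "(\<Sum>k\<le>m + j. of_nat (if k < j then 0 else m choose (k - j)) * q ^ (m + j - k) * p ^ k)
    = p ^ j"
    (is "?L = _")
proof -
  have "?L = (\<Sum>k=0+j..m+j. of_nat (m choose (k - j)) * q ^ (m + j - k) * p ^ k)"
    by (rule sum.mono_neutral_cong_right) auto
  \<comment> \<open>Only \<open>k \<ge> j\<close> survives the guard. Without it, truncated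
    \<open>k - j\<close> would contribute \<open>m choose 0 = 1\<close> for each
    \<open>k < j\<close>.\<close>
  also have "\<dots> = (\<Sum>i=0..m. of_nat (m choose i) * q ^ (m - i) * p ^ (i + j))"
    by (subst sum.shift_bounds_cl_nat_ivl) simp
  also have "\<dots> = p ^ j * (p + q) ^ m"
    unfolding binomial_ring sum_distrib_left
    by (rule sum.cong) (auto simp: power_add mult_ac)
  finally show ?thesis using assms by simp
qed

text \<open>The empty set is its own closed neighborhood, and a step needs a vertex already in the
  current set.\<close>

lemma Obs_empty:
  assumes "graph G"
  shows "Obs G {} = {}"
proof -
  have "pd_final G {} {}"
    by (auto simp: pd_final_def closed_nbhd_def pd_step_def)
  then show ?thesis
    unfolding Obs_def using pd_final_ex1[OF assms, of "{}"] by (simp add: the1_equality)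
qed

lemma expected_obs_eq_bernstein_sum:
  assumes "finite S"
  shows "expected_obs G S = (\<Sum>k\<le>card S.
    [:real (\<Sum>W\<in>{W. W \<subseteq> S \<and> card W = k}. card (Obs G W)):] * [:0, 1:] ^ (card S - k) * [:1, -1:] ^ k)"
proof -
  let ?h = "\<lambda>W. of_nat (card (Obs G W)) * [:0, 1:] ^ card (S - W) * [:1, -1:] ^ card W :: real poly"
  have "expected_obs G S = (\<Sum>k\<le>card S. \<Sum>W\<in>{W \<in> Pow S. card W = k}. ?h W)"
    unfolding expected_obs_def
    by (rule sum.group[symmetric]) (use assms in \<open>auto intro: card_mono\<close>)
  also have "\<dots> = (\<Sum>k\<le>card S.
    [:real (\<Sum>W\<in>{W. W \<subseteq> S \<and> card W = k}. card (Obs G W)):] * [:0, 1:] ^ (card S - k) * [:1, -1:] ^ k)"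
  proof (rule sum.cong[OF refl])
    fix k
    have "(\<Sum>W\<in>{W \<in> Pow S. card W = k}. ?h W) =
      (\<Sum>W\<in>{W. W \<subseteq> S \<and> card W = k}. of_nat (card (Obs G W)) * ([:0, 1:] ^ (card S - k) * [:1, -1:] ^ k))"
      using assms by (intro sum.cong) (auto simp: card_Diff_subset finite_subset)
    also have "\<dots> = of_nat (\<Sum>W\<in>{W. W \<subseteq> S \<and> card W = k}. card (Obs G W))
        * ([:0, 1:] ^ (card S - k) * [:1, -1:] ^ k)"
      by (simp only: of_nat_sum sum_distrib_right)
    finally show "(\<Sum>W\<in>{W \<in> Pow S. card W = k}. ?h W) =
      [:real (\<Sum>W\<in>{W. W \<subseteq> S \<and> card W = k}. card (Obs G W)):] * [:0, 1:] ^ (card S - k) * [:1, -1:] ^ k"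
      by (simp only: of_nat_poly mult.assoc)
  qed
  finally show ?thesis .
qed

text \<open>The three weights are the coefficients of the quadratic expanded around
  \<open>q = 1\<close>. The bound \<open>2 \<le> s\<close> lets \<open>(1 - q)^2\<close> be written
  in degree \<open>s\<close>.\<close>

lemma quadratic_bernstein_coeffs:
  fixes f :: "nat \<Rightarrow> 'a::idom"
  assumes "(\<Sum>k\<le>s. [:f k:] * [:0, 1:] ^ (s - k) * [:1, -1:] ^ k) = [:c, - b, a:]"
    and "2 \<le> s" "k \<le> s"
  shows "f k = of_nat (s choose k) * (a - b + c)
    + of_nat (if k < 1 then 0 else (s - 1) choose (k - 1)) * (b - 2 * a)
    + of_nat (if k < 2 then 0 else (s - 2) choose (k - 2)) * a"
proof -
  define B :: "nat \<Rightarrow> nat \<Rightarrow> 'a"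
    where "B j k = of_nat (if k < j then 0 else (s - j) choose (k - j))" for j k
  define m :: "nat \<Rightarrow> 'a poly" where "m k = [:0, 1:] ^ (s - k) * [:1, -1:] ^ k" for k
  \<comment> \<open>The discrepancy from the claimed value: its Bernstein sum will be 0, so
    independence forces each \<open>g k\<close> to vanish.\<close>
  define g where "g k = f k - (B 0 k * (a - b + c) + B 1 k * (b - 2 * a) + B 2 k * a)" for k
  have B: "(\<Sum>k\<le>s. [:B j k:] * m k) = [:1, -1:] ^ j" if "j \<le> s" for j
    using power_eq_bernstein_sum[of "[:1, -1:]" "[:0, 1::'a:]" j "s - j"] that
    by (simp add: B_def m_def of_nat_poly mult.assoc one_pCons)
  have g: "[:g k:] * m k = [:f k:] * m k - [:a - b + c:] * ([:B 0 k:] * m k)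
      - [:b - 2 * a:] * ([:B 1 k:] * m k) - [:a:] * ([:B 2 k:] * m k)" for k
    by (simp add: g_def smult_diff_left smult_add_left mult_ac)
  have "(\<Sum>k\<le>s. [:g k:] * m k) = [:c, - b, a:] - [:a - b + c:] * [:1, -1:] ^ 0
      - [:b - 2 * a:] * [:1, -1:] ^ 1 - [:a:] * [:1, -1:] ^ 2"
    unfolding g sum_subtractf sum_distrib_left[symmetric]
    using B[of 0] B[of 1] B[of 2] assms(1,2) by (simp only: m_def mult.assoc)
  also have "\<dots> = 0"
    by (simp add: power2_eq_square algebra_simps)
  finally have "g k = 0"
    using bernstein_coeffs_eq_0[of g s k] assms(3) by (simp add: m_def mult.assoc)
  then show ?thesis by (simp add: g_def B_def)
qed

theorem theorem3p7:
  fixes G :: "('a, 'b) pre_digraph" and S :: "'a set" and s :: nat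
    and a :: int and b c :: real
  assumes "graph G"
    and "S \<subseteq> verts G"
    and "card S = s"
    and "b \<ge> max (of_nat s + 2 * of_int a + 16) (of_nat s + 6)"
    and "expected_obs G S = [:c, - b, of_int a:]"
  shows "\<forall>k::nat. 1 \<le> k \<and> k \<le> s \<longrightarrow>
    (\<Sum>W\<in>{W. W \<subseteq> S \<and> card W = k}. int (card (Obs G W))) =
      int_binom (int s - 2) (int k - 2) * (\<Sum>W\<in>{W. W \<subseteq> S \<and> card W = 2}. int (card (Obs G W)))
      + (int_binom (int s - 1) (int k - 1) - (int s - 1) * int_binom (int s - 2) (int k - 2))
        * (\<Sum>v\<in>S. int (card (Obs G {v})))"
proof (intro allI impI)
  fix k :: nat assume k: "1 \<le> k \<and> k \<le> s"
  define f where "f k = (\<Sum>W\<in>{W. W \<subseteq> S \<and> card W = k}. card (Obs G W))" for k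
  interpret graph G by fact
  have fin: "finite S" using assms(2) by (rule finite_subset) simp
  have int_f: "(\<Sum>W\<in>{W. W \<subseteq> S \<and> card W = k}. int (card (Obs G W))) = int (f k)" for k
    by (simp add: f_def)
  have "{W. W \<subseteq> S \<and> card W = 1} = (\<lambda>v. {v}) ` S"
    by (auto simp: card_1_singleton_iff)
  then have "f 1 = (\<Sum>v\<in>S. card (Obs G {v}))"
    by (simp add: f_def sum.reindex)
  then have f1: "(\<Sum>v\<in>S. int (card (Obs G {v}))) = int (f 1)"
    by simp
  have "{W. W \<subseteq> S \<and> card W = 0} = {{}}"
    using fin by (auto simp: finite_subset)
  then have f0: "f 0 = 0"
    by (simp add: f_def Obs_empty[OF assms(1)])
  have bern: "(\<Sum>k\<le>s. [:real (f k):] * [:0, 1:] ^ (s - k) * [:1, -1:] ^ k)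
      = [:c, - b, of_int a:]"
    using expected_obs_eq_bernstein_sum[OF fin, of G] assms(3,5) by (simp only: f_def)
  have "int (f k) = int_binom (int s - 2) (int k - 2) * int (f 2)
    + (int_binom (int s - 1) (int k - 1) - (int s - 1) * int_binom (int s - 2) (int k - 2))
      * int (f 1)"
  \<comment> \<open>For \<open>s = k = 1\<close> the lower index \<open>k - 2\<close> is negative,
    so both binomials containing it are 0 and the identity reads \<open>f 1 = f 1\<close>.\<close>
  proof (cases "2 \<le> s")
    case False
    with k have "s = 1" "k = 1" by auto
    then show ?thesis by (simp add: int_binom_def)
  next
    case True
    note coeff = quadratic_bernstein_coeffs[OF bern True]
    \<comment> \<open>At \<open>k = 0\<close> only the constant weight contributes, and no vertex is
      observed from the empty set.\<close>
    have c0: "of_int a - b + c = 0"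
      using coeff[of 0] f0 by simp
    have c1: "real (f 1) = b - 2 * of_int a"
      using coeff[of 1] c0 True by simp
    have c2: "real (f 2) = (real s - 1) * (b - 2 * of_int a) + of_int a"
      using coeff[of 2] c0 True by (simp add: of_nat_diff)
    have b1: "of_int (int_binom (int s - 1) (int k - 1))
        = real (if k < 1 then 0 else (s - 1) choose (k - 1))"
      using k by (simp add: int_binom_def nat_diff_distrib')
    \<comment> \<open>At \<open>k = 1\<close> both sides are 0: the negative index on the left
      matches the guard on the right.\<close>
    have b2: "of_int (int_binom (int s - 2) (int k - 2))
        = real (if k < 2 then 0 else (s - 2) choose (k - 2))"
      using True by (auto simp: int_binom_def nat_diff_distrib')
    have "real (f k) = of_int (int_binom (int s - 1) (int k - 1)) * (b - 2 * of_int a)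
        + of_int (int_binom (int s - 2) (int k - 2)) * of_int a"
      using coeff[of k] k c0 by (simp add: b1 b2)
    \<comment> \<open>The weights are eliminated through \<open>b - 2a = f 1\<close> and
      \<open>a = f 2 - (s - 1) * f 1\<close>; the latter produces the correction term in the factor
      of \<open>f 1\<close>.\<close>
    also have "\<dots> = of_int (int_binom (int s - 2) (int k - 2) * int (f 2)
      + (int_binom (int s - 1) (int k - 1) - (int s - 1) * int_binom (int s - 2) (int k - 2))
        * int (f 1))"
      by (simp add: c1[simplified] c2 algebra_simps)
    finally have "real_of_int (int (f k)) = of_int (int_binom (int s - 2) (int k - 2) * int (f 2)
      + (int_binom (int s - 1) (int k - 1) - (int s - 1) * int_binom (int s - 2) (int k - 2))
        * int (f 1))"
      by simp
    then show ?thesis by (simp only: of_int_eq_iff)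
  qed
  then show "(\<Sum>W\<in>{W. W \<subseteq> S \<and> card W = k}. int (card (Obs G W))) =
      int_binom (int s - 2) (int k - 2) * (\<Sum>W\<in>{W. W \<subseteq> S \<and> card W = 2}. int (card (Obs G W)))
      + (int_binom (int s - 1) (int k - 1) - (int s - 1) * int_binom (int s - 2) (int k - 2))
        * (\<Sum>v\<in>S. int (card (Obs G {v})))"
    by (simp only: int_f f1)
qed

end
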